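(* Let $m,k,n$ be positive integers and let $A_1,\dots,A_n\in\mathbb{R}_+^{m\times k}$. Let $\Delta=\{x\in\mathbb{R}^k: \mathbf{1}^\top x=1,\ x\ge 0\}$ and suppose there exist $x_1^*,\dots,x_n^*\in\Delta$ with $\sum_{t=1}^n A_t x_t^*\le \mathbf{1}$ (componentwise, $\mathbf 1\in\mathbb{R}^m$). Let $\gamma=\max_{t,i,j}(A_t)_{i,j}>0$. Let $\epsilon\in(0,1)$ be such that $\log_2(1/\epsilon)$ and $n\epsilon$ are integers, and let $T=n(1-\epsilon)$. Let $\sigma$ be a permutation of $[n]=\{1,\dots,n\}$ chosen uniformly at random, set $\nu=\frac{1}{\gamma}\log(1+\epsilon)$, and define $x_1,\dots,x_n$ recursively (Algorithm 1) by choosing, for $t=1,\dots,n$, $$x_t\in\arg\min_{z\in\Delta}\ \sum_{i=1}^m \exp\Big(\nu\sum_{s=1}^{t-1}(A_{\sigma(s)}x_s)_i\Big)\,(A_{\sigma(t)}z)_i$$ (with ties broken by any fixed rule). If $\epsilon\le \frac14$ and $\gamma\le \frac{\epsilon^2}{12\log(m/\epsilon)}$, then $$\mathbb{P}\Big(\max_{i\in[m]}\sum_{s=1}^{T}(A_{\sigma(s)}x_s)_i>1+2\epsilon\Big)\le\epsilon,$$ where the probability is over the random permutation $\sigma$.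
   Context: All vector inequalities are componentwise. The algorithm at time $t$ sees only $A_{\sigma(1)},\dots,A_{\sigma(t)}$ and the previously chosen $x_1,\dots,x_{t-1}$. *)

theory Defs
  imports Complex_Main "HOL-Combinatorics.Permutations"
begin

text \<open>Vectors in R^k are represented as functions nat => real, supported on {0..<k};
 m x k matrices as functions nat => nat => real (row i < m, column j < k).\<close>

definition simplex :: "nat \<Rightarrow> (nat \<Rightarrow> real) set" where
  "simplex k = {z. (\<forall>j<k. 0 \<le> z j) \<and> (\<Sum>j<k. z j) = 1 \<and> (\<forall>j\<ge>k. z j = 0)}"

definition matvec :: "nat \<Rightarrow> (nat \<Rightarrow> nat \<Rightarrow> real) \<Rightarrow> (nat \<Rightarrow> real) \<Rightarrow> nat \<Rightarrow> real" where
  "matvec k M z i = (\<Sum>j<k. M i j * z j)"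

text \<open>Objective of Algorithm 1 at time t: Ms = [A_sigma(1),...,A_sigma(t)],
  xs = [x_1,...,x_(t-1)].\<close>
definition alg_obj :: "nat \<Rightarrow> nat \<Rightarrow> real \<Rightarrow> (nat \<Rightarrow> nat \<Rightarrow> real) list \<Rightarrow> (nat \<Rightarrow> real) list
    \<Rightarrow> (nat \<Rightarrow> real) \<Rightarrow> real" where
  "alg_obj m k \<nu> Ms xs z =
     (\<Sum>i<m. exp (\<nu> * (\<Sum>s<length xs. matvec k (Ms ! s) (xs ! s) i)) * matvec k (last Ms) z i)"

definition is_argmin_step :: "nat \<Rightarrow> nat \<Rightarrow> real \<Rightarrow> (nat \<Rightarrow> nat \<Rightarrow> real) list \<Rightarrow> (nat \<Rightarrow> real) list
    \<Rightarrow> (nat \<Rightarrow> real) \<Rightarrow> bool" where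
  "is_argmin_step m k \<nu> Ms xs z \<longleftrightarrow>
     z \<in> simplex k \<and> (\<forall>z' \<in> simplex k. alg_obj m k \<nu> Ms xs z \<le> alg_obj m k \<nu> Ms xs z')"

text \<open>Run of Algorithm 1 with a fixed selection rule \<open>rule\<close>, which at time t is given the
  matrices A_sigma(1..t) and the previous choices x_1..x_(t-1).
  \<open>alg_run rule A \<sigma> t\<close> = [x_1, ..., x_t].\<close>
fun alg_run :: "((nat \<Rightarrow> nat \<Rightarrow> real) list \<Rightarrow> (nat \<Rightarrow> real) list \<Rightarrow> (nat \<Rightarrow> real))
    \<Rightarrow> (nat \<Rightarrow> nat \<Rightarrow> nat \<Rightarrow> real) \<Rightarrow> (nat \<Rightarrow> nat) \<Rightarrow> nat \<Rightarrow> (nat \<Rightarrow> real) list" where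
  "alg_run rule A \<sigma> 0 = []"
| "alg_run rule A \<sigma> (Suc t) =
     (let xs = alg_run rule A \<sigma> t in xs @ [rule (map (\<lambda>s. A (\<sigma> s)) [1..<t+2]) xs])"

end

theory Submission
  imports Defs "HOL-Analysis.Convex"
begin

text \<open>
  Let \<open>\<Phi> t\<close> be the sum over \<open>i\<close> of \<open>exp (\<nu> load\<^sub>i)\<close> after \<open>t\<close> steps, and let \<open>\<rho> t\<close> be the maximum over
  \<open>i\<close> of the mean of \<open>(A\<^sub>u x*\<^sub>u)\<^sub>i\<close> over the indices \<open>u\<close> not yet revealed before step \<open>t\<close>.  The greedy choice
  is at least as good as \<open>x*\<close>, so conditionally on the past \<open>\<Phi>\<close> grows by a factor of at most
  \<open>1 + (\<epsilon> / \<gamma>) \<rho> t\<close>.  Hence \<open>\<Phi> T\<close> divided by the (random) product of these factors has expectation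
  at most \<open>m\<close>, and by Markov's inequality it exceeds \<open>2m / \<epsilon>\<close> with probability at most \<open>\<epsilon> / 2\<close>.

  It remains to show that \<open>\<rho> 1 + \<dots> + \<rho> T\<close> exceeds \<open>1 + \<epsilon> / 2\<close> with probability at most \<open>\<epsilon> / 2\<close>.  By
  Maclaurin's inequality the mean of a uniformly random \<open>q\<close>-subset has the same exponential moment
  bounds as under sampling with replacement.  The deviation of \<open>\<rho> t\<close> above \<open>1 / n\<close> is thus of order
  \<open>\<epsilon> / sqrt (n q)\<close> with \<open>q = n + 1 - t\<close>, and these deviations sum to \<open>O(\<epsilon>)\<close>.
\<close>

section \<open>Symmetry of uniformly random permutations\<close>

text \<open>Exchangeability: composing with a transposition is a bijection of the permutations of
  \<open>S\<close>. All conditioning on the past is done by such swaps of positions.\<close>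

lemma sum_permutes_transpose:
  assumes "a \<in> S" "b \<in> S"
  shows "(\<Sum>\<sigma> | \<sigma> permutes S. g (\<sigma> \<circ> transpose a b)) = (\<Sum>\<sigma> | \<sigma> permutes S. g \<sigma>)"
  using sum_permutations_compose_right[OF permutes_swap_id[OF assms], of g] by simp

text \<open>Maclaurin's inequality: swapping positions \<open>x\<close> and \<open>i\<close> turns \<open>f (\<sigma> x)\<close> into \<open>f (\<sigma> i)\<close>
  at no loss, by \<open>2ab \<le> a\<^sup>2 + b\<^sup>2\<close> when \<open>i\<close> is already in use.\<close>
lemma sum_permutes_prod_le:
  fixes f :: "'a \<Rightarrow> real"
  assumes S: "finite S" "J \<subseteq> S" and f: "\<And>u. u \<in> S \<Longrightarrow> 0 \<le> f u"
  shows "(\<Sum>\<sigma> | \<sigma> permutes S. \<Prod>j\<in>J. f (\<sigma> j))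
    \<le> fact (card S) * ((\<Sum>u\<in>S. f u) / card S) ^ card J"
proof -
  have "finite J" using S finite_subset by auto
  then show ?thesis using S(2)
  proof (induction J rule: finite_induct)
    case empty
    then show ?case using S card_permutations[of S "card S"] by simp
  next
    case (insert x J)
    let ?P = "{\<sigma>. \<sigma> permutes S}"
    let ?B = "\<lambda>J \<sigma>. \<Prod>j\<in>J. f (\<sigma> j)"
    have xS: "x \<in> S" and JS: "J \<subseteq> S" using insert.prems by auto
    have n0: "card S > 0" using xS S(1) card_gt_0_iff by blast
    have B0: "0 \<le> ?B K \<sigma>" if "K \<subseteq> S" "\<sigma> \<in> ?P" for K \<sigma>
      using that f by (intro prod_nonneg) (auto simp: permutes_in_image)
    have swap: "(\<Sum>\<sigma>\<in>?P. ?B J \<sigma> * f (\<sigma> x)) \<le> (\<Sum>\<sigma>\<in>?P. ?B J \<sigma> * f (\<sigma> i))" if i: "i \<in> S" for i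
    proof (cases "i \<in> J")
      case False
      have "?B J (\<sigma> \<circ> transpose x i) = ?B J \<sigma>" for \<sigma>
        using False insert.hyps(2) by (intro prod.cong) (auto simp: transpose_def)
      then show ?thesis
        using sum_permutes_transpose[OF xS i, of "\<lambda>\<sigma>. ?B J \<sigma> * f (\<sigma> x)"] by simp
    next
      case True
      let ?K = "J - {i}"
      have BJ: "?B J \<sigma> = f (\<sigma> i) * ?B ?K \<sigma>" for \<sigma>
        using True insert.hyps(1) by (simp add: prod.remove)
      \<comment> \<open>The set \<open>?K\<close> contains neither \<open>x\<close> nor
        \<open>i\<close>, so the swap only exchanges the two squared values.\<close>
      have "?B ?K (\<sigma> \<circ> transpose x i) = ?B ?K \<sigma>" for \<sigma>
        using insert.hyps(2) by (intro prod.cong) (auto simp: transpose_def)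
      then have sq: "(\<Sum>\<sigma>\<in>?P. ?B ?K \<sigma> * (f (\<sigma> i))\<^sup>2) = (\<Sum>\<sigma>\<in>?P. ?B ?K \<sigma> * (f (\<sigma> x))\<^sup>2)"
        using sum_permutes_transpose[OF xS i, of "\<lambda>\<sigma>. ?B ?K \<sigma> * (f (\<sigma> x))\<^sup>2"] by simp
      have "2 * (\<Sum>\<sigma>\<in>?P. ?B J \<sigma> * f (\<sigma> x)) = (\<Sum>\<sigma>\<in>?P. ?B ?K \<sigma> * (2 * f (\<sigma> i) * f (\<sigma> x)))"
        by (simp add: sum_distrib_left BJ mult_ac)
      also have "\<dots> \<le> (\<Sum>\<sigma>\<in>?P. ?B ?K \<sigma> * ((f (\<sigma> i))\<^sup>2 + (f (\<sigma> x))\<^sup>2))"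
      proof (intro sum_mono mult_left_mono)
        fix \<sigma> assume "\<sigma> \<in> ?P"
        then show "0 \<le> ?B ?K \<sigma>" using B0[of ?K \<sigma>] JS by auto
        show "2 * f (\<sigma> i) * f (\<sigma> x) \<le> (f (\<sigma> i))\<^sup>2 + (f (\<sigma> x))\<^sup>2" by (rule sum_squares_bound)
      qed
      also have "\<dots> = 2 * (\<Sum>\<sigma>\<in>?P. ?B ?K \<sigma> * (f (\<sigma> i))\<^sup>2)"
        by (simp add: distrib_left sum.distrib sq)
      also have "\<dots> = 2 * (\<Sum>\<sigma>\<in>?P. ?B J \<sigma> * f (\<sigma> i))"
        by (simp add: BJ power2_eq_square mult_ac)
      finally show ?thesis by simp
    qed
    have tot: "(\<Sum>i\<in>S. f (\<sigma> i)) = (\<Sum>u\<in>S. f u)" if "\<sigma> \<in> ?P" for \<sigma>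
      using that sum.permute[of \<sigma> S f] by (simp add: o_def)
    \<comment> \<open>Summing \<open>swap\<close> over all \<open>i\<close> turns the new factor
      into the total of \<open>f\<close> over \<open>S\<close>, which is the same for every
      permutation and leaves the sum.\<close>
    have "card S * (\<Sum>\<sigma>\<in>?P. ?B (insert x J) \<sigma>) = (\<Sum>i\<in>S. \<Sum>\<sigma>\<in>?P. ?B J \<sigma> * f (\<sigma> x))"
      using insert.hyps by (simp add: mult.commute)
    also have "\<dots> \<le> (\<Sum>i\<in>S. \<Sum>\<sigma>\<in>?P. ?B J \<sigma> * f (\<sigma> i))"
      by (intro sum_mono swap)
    also have "\<dots> = (\<Sum>\<sigma>\<in>?P. ?B J \<sigma> * (\<Sum>i\<in>S. f (\<sigma> i)))"
      by (subst sum.swap) (simp add: sum_distrib_left)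
    also have "\<dots> = (\<Sum>\<sigma>\<in>?P. ?B J \<sigma>) * (\<Sum>u\<in>S. f u)"
      by (simp add: sum_distrib_right tot)
    also have "\<dots> \<le> fact (card S) * ((\<Sum>u\<in>S. f u) / card S) ^ card J * (\<Sum>u\<in>S. f u)"
      using insert.IH JS f by (intro mult_right_mono sum_nonneg) auto
    finally show ?case
      using n0 insert.hyps by (simp add: field_simps)
  qed
qed

section \<open>Elementary inequalities\<close>

text \<open>By convexity, \<open>exp\<close> lies below its chord over \<open>[0, c * g]\<close>.
  This serves both the growth of the potential and the exponential moments of the tail
  means.\<close>

lemma exp_chord_le:
  fixes a c g :: real
  assumes "0 \<le> a" "a \<le> g" "0 < g"
  shows "exp (c * a) \<le> 1 + (exp (c * g) - 1) / g * a"
proof -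
  have "exp (c * a) = exp ((1 - a / g) *\<^sub>R 0 + (a / g) *\<^sub>R (c * g))"
    using assms by simp
  also have "\<dots> \<le> (1 - a / g) * exp 0 + a / g * exp (c * g)"
    using assms by (intro convex_onD[OF exp_convex]) auto
  also have "\<dots> = 1 + (exp (c * g) - 1) / g * a"
    using assms by (simp add: field_simps)
  finally show ?thesis .
qed

text \<open>The difference of the two sides has derivative \<open>y\<^sup>2 / (1 + y)\<close>. The
  bound is used to compare \<open>ln (1 + \<epsilon>)\<close> with \<open>\<epsilon>\<close> in the
  last estimate.\<close>

lemma ln_one_plus_ge:
  fixes x :: real
  assumes "0 \<le> x"
  shows "x - x\<^sup>2 / 2 \<le> ln (1 + x)"
proof -
  have "ln (1 + 0) - (0 - 0\<^sup>2 / 2) \<le> ln (1 + x) - (x - x\<^sup>2 / 2)"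
  proof (rule DERIV_nonneg_imp_nondecreasing[OF assms])
    fix y :: real assume y: "0 \<le> y" "y \<le> x"
    have "((\<lambda>y. ln (1 + y) - (y - y\<^sup>2 / 2)) has_real_derivative 1 / (1 + y) - (1 - y)) (at y)"
      using y by (auto intro!: derivative_eq_intros)
    moreover have "0 \<le> 1 / (1 + y) - (1 - y)"
      using y by (simp add: field_simps)
    ultimately show "\<exists>d. ((\<lambda>y. ln (1 + y) - (y - y\<^sup>2 / 2)) has_real_derivative d) (at y) \<and> 0 \<le> d"
      by blast
  qed
  then show ?thesis by simp
qed

text \<open>The right-hand side telescopes, since
  \<open>1 / sqrt q \<le> 2 * (sqrt q - sqrt (q - 1))\<close>.\<close>

lemma sum_inverse_sqrt_le:
  fixes n T :: nat
  assumes "T \<le> n"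
  shows "(\<Sum>t=1..T. 1 / sqrt (real (n + 1 - t))) \<le> 2 * (sqrt n - sqrt (real (n - T)))"
  using assms
proof (induction T)
  case (Suc T)
  let ?q = "real (n - T)"
  have q: "1 \<le> ?q" and d: "real (n - Suc T) = ?q - 1" using Suc.prems by auto
  have "1 = (sqrt ?q - sqrt (?q - 1)) * (sqrt ?q + sqrt (?q - 1))"
    using q by (simp add: algebra_simps flip: power2_eq_square)
  also have "\<dots> \<le> (sqrt ?q - sqrt (?q - 1)) * (sqrt ?q + sqrt ?q)"
    using q by (intro mult_left_mono) auto
  finally have "1 / sqrt ?q \<le> 2 * (sqrt ?q - sqrt (?q - 1))"
    using q by (simp add: field_simps)
  moreover have "n + 1 - Suc T = n - T" by simp
  ultimately show ?case using Suc unfolding d by (simp add: algebra_simps del: of_nat_diff)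
qed simp

text \<open>Markov's inequality in counting form.\<close>

lemma card_gt_mult_le_sum:
  fixes X :: "'a \<Rightarrow> real"
  assumes "finite P" "\<And>\<sigma>. \<sigma> \<in> P \<Longrightarrow> 0 \<le> X \<sigma>"
  shows "real (card {\<sigma> \<in> P. c < X \<sigma>}) * c \<le> (\<Sum>\<sigma>\<in>P. X \<sigma>)"
proof -
  have "real (card {\<sigma> \<in> P. c < X \<sigma>}) * c = (\<Sum>\<sigma> | \<sigma> \<in> P \<and> c < X \<sigma>. c)" by simp
  also have "\<dots> \<le> (\<Sum>\<sigma> | \<sigma> \<in> P \<and> c < X \<sigma>. X \<sigma>)" by (intro sum_mono) auto
  also have "\<dots> \<le> (\<Sum>\<sigma>\<in>P. X \<sigma>)" using assms by (intro sum_mono2) auto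
  finally show ?thesis .
qed

section \<open>Averages over unrevealed indices and the potential\<close>

text \<open>For \<open>1 \<le> t \<le> n\<close> this is the conditional expectation of
  \<open>h (\<sigma> t) i\<close> given
  \<open>\<sigma> 1, \<dots>, \<sigma> (t - 1)\<close>.\<close>

definition tail_mean :: "nat \<Rightarrow> (nat \<Rightarrow> 'i \<Rightarrow> real) \<Rightarrow> nat \<Rightarrow> (nat \<Rightarrow> nat) \<Rightarrow> 'i \<Rightarrow> real" where
  "tail_mean n h t \<sigma> i = (\<Sum>j=t..n. h (\<sigma> j) i) / real (n + 1 - t)"

definition tail_max :: "'i set \<Rightarrow> nat \<Rightarrow> (nat \<Rightarrow> 'i \<Rightarrow> real) \<Rightarrow> nat \<Rightarrow> (nat \<Rightarrow> nat) \<Rightarrow> real" where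
  "tail_max I n h t \<sigma> = Max (tail_mean n h t \<sigma> ` I)"

lemma tail_mean_nonneg:
  assumes "\<sigma> permutes {1..n}" "\<And>u. u \<in> {1..n} \<Longrightarrow> 0 \<le> h u i" "1 \<le> t"
  shows "0 \<le> tail_mean n h t \<sigma> i"
proof -
  have "0 \<le> h (\<sigma> j) i" if "j \<in> {t..n}" for j
    using that assms(2)[of "\<sigma> j"] permutes_in_image[OF assms(1), of j] assms(3) by auto
  then show ?thesis unfolding tail_mean_def by (intro divide_nonneg_nonneg sum_nonneg) auto
qed

lemma tail_mean_le_tail_max:
  assumes "finite I" "i \<in> I"
  shows "tail_mean n h t \<sigma> i \<le> tail_max I n h t \<sigma>"
  unfolding tail_max_def using assms by (intro Max_ge) auto

lemma tail_max_eq: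
  assumes "finite I" "I \<noteq> {}"
  obtains i where "i \<in> I" "tail_max I n h t \<sigma> = tail_mean n h t \<sigma> i"
proof -
  have "tail_max I n h t \<sigma> \<in> tail_mean n h t \<sigma> ` I"
    unfolding tail_max_def using assms by (intro Max_in) auto
  then show ?thesis using that by auto
qed

lemma tail_max_nonneg:
  assumes "finite I" "I \<noteq> {}" "\<sigma> permutes {1..n}" "1 \<le> t"
    and "\<And>u i. u \<in> {1..n} \<Longrightarrow> i \<in> I \<Longrightarrow> 0 \<le> h u i"
  shows "0 \<le> tail_max I n h t \<sigma>"
proof -
  obtain i where "i \<in> I" "tail_max I n h t \<sigma> = tail_mean n h t \<sigma> i"
    using tail_max_eq[OF assms(1,2)] by metis
  then show ?thesis using tail_mean_nonneg[OF assms(3), of h i t] assms(4,5) by simp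
qed

text \<open>Only the set of values at positions \<open>s\<close> to \<open>n\<close> matters, not
  their order; thus \<open>tail_max\<close> at \<open>s\<close> is determined by the first
  \<open>s - 1\<close> revealed indices.\<close>

lemma tail_max_transpose:
  assumes "s \<le> a" "a \<le> n" "s \<le> b" "b \<le> n"
  shows "tail_max I n h s (\<sigma> \<circ> transpose a b) = tail_max I n h s \<sigma>"
proof -
  have "transpose a b permutes {s..n}" using assms by (intro permutes_swap_id) auto
  then have "(\<Sum>j=s..n. h ((\<sigma> \<circ> transpose a b) j) i) = (\<Sum>j=s..n. h (\<sigma> j) i)" for i
    using sum.permute[of _ _ "\<lambda>j. h (\<sigma> j) i"] by (simp add: o_def)
  then have "tail_mean n h s (\<sigma> \<circ> transpose a b) = tail_mean n h s \<sigma>"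
    unfolding tail_mean_def by simp
  then show ?thesis by (simp add: tail_max_def)
qed

text \<open>\<open>\<Phi> / \<Prod>(1 + c \<rho>)\<close> is a supermartingale: conditionally on \<open>\<sigma> 1, \<dots>, \<sigma> t\<close>, the vector
  \<open>h (\<sigma> (t + 1))\<close> has mean \<open>tail_mean n h (t + 1) \<sigma>\<close>.\<close>
lemma sum_permutes_potential_le:
  fixes w :: "nat \<Rightarrow> (nat \<Rightarrow> nat) \<Rightarrow> 'i \<Rightarrow> real"
  assumes I: "finite I" "I \<noteq> {}" and c: "0 \<le> c" and T: "T \<le> n"
    and h: "\<And>u i. u \<in> {1..n} \<Longrightarrow> i \<in> I \<Longrightarrow> 0 \<le> h u i"
    and w_nonneg: "\<And>t \<sigma> i. 0 \<le> w t \<sigma> i"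
    and w_adapted: "\<And>t \<sigma> \<tau> i. (\<And>s. s \<in> {1..t} \<Longrightarrow> \<sigma> s = \<tau> s) \<Longrightarrow> w t \<sigma> i = w t \<tau> i"
    and w_init: "\<And>\<sigma> i. w 0 \<sigma> i = 1"
    and w_step: "\<And>t \<sigma>. t < n \<Longrightarrow> \<sigma> permutes {1..n} \<Longrightarrow>
      (\<Sum>i\<in>I. w (Suc t) \<sigma> i) \<le> (\<Sum>i\<in>I. w t \<sigma> i) + c * (\<Sum>i\<in>I. w t \<sigma> i * h (\<sigma> (Suc t)) i)"
  shows "(\<Sum>\<sigma> | \<sigma> permutes {1..n}.
      (\<Sum>i\<in>I. w T \<sigma> i) / (\<Prod>s=1..T. 1 + c * tail_max I n h s \<sigma>)) \<le> fact n * card I"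
  using T
proof (induction T)
  case 0
  then show ?case by (simp add: w_init card_permutations)
next
  case (Suc t)
  let ?P = "{\<sigma>. \<sigma> permutes {1..n}}"
  let ?\<Phi> = "\<lambda>t \<sigma>. \<Sum>i\<in>I. w t \<sigma> i"
  let ?D = "\<lambda>t \<sigma>. \<Prod>s=1..t. 1 + c * tail_max I n h s \<sigma>"
  \<comment> \<open>The divisor may include the factor of step \<open>Suc t\<close>, because that
    factor is already determined by the first \<open>t\<close> positions.\<close>
  let ?G = "\<lambda>\<sigma> i. w t \<sigma> i / ?D (Suc t) \<sigma>"
  let ?\<rho> = "tail_max I n h (Suc t)"
  let ?q = "real (n - t)"
  have q: "?q > 0" using Suc.prems by simp
  have Dfac: "0 < 1 + c * tail_max I n h s \<sigma>" if "\<sigma> \<in> ?P" "1 \<le> s" for \<sigma> s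
    using tail_max_nonneg[OF I, of \<sigma> n s h] that h c by (simp add: add_pos_nonneg)
  have D: "0 < ?D t \<sigma>" if "\<sigma> \<in> ?P" for t \<sigma>
    using that Dfac by (intro prod_pos) auto
  have G0: "0 \<le> ?G \<sigma> i" if "\<sigma> \<in> ?P" for \<sigma> i
    using D[OF that, of "Suc t"] w_nonneg by (intro divide_nonneg_nonneg) auto
  \<comment> \<open>Both swapped positions lie after \<open>t\<close>, where \<open>w t\<close> does
    not look, and inside every tail that enters \<open>?D (Suc t)\<close>.\<close>
  have swap: "(\<Sum>\<sigma>\<in>?P. ?G \<sigma> i * h (\<sigma> j) i) = (\<Sum>\<sigma>\<in>?P. ?G \<sigma> i * h (\<sigma> (Suc t)) i)"
    if j: "j \<in> {Suc t..n}" for i j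
  proof -
    have "w t (\<sigma> \<circ> transpose (Suc t) j) i = w t \<sigma> i" for \<sigma>
      using j by (intro w_adapted) (auto simp: transpose_def)
    moreover have "?D (Suc t) (\<sigma> \<circ> transpose (Suc t) j) = ?D (Suc t) \<sigma>" for \<sigma>
      using j Suc.prems by (intro prod.cong refl) (subst tail_max_transpose, auto)
    ultimately show ?thesis
      using sum_permutes_transpose[of "Suc t" "{1..n}" j "\<lambda>\<sigma>. ?G \<sigma> i * h (\<sigma> (Suc t)) i"] j
      by simp
  qed
  have mean: "(\<Sum>\<sigma>\<in>?P. ?G \<sigma> i * h (\<sigma> (Suc t)) i) = (\<Sum>\<sigma>\<in>?P. ?G \<sigma> i * tail_mean n h (Suc t) \<sigma> i)" for i
  proof -
    have "?q * (\<Sum>\<sigma>\<in>?P. ?G \<sigma> i * h (\<sigma> (Suc t)) i) = (\<Sum>j=Suc t..n. \<Sum>\<sigma>\<in>?P. ?G \<sigma> i * h (\<sigma> j) i)"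
    proof -
      have "(\<Sum>j=Suc t..n. \<Sum>\<sigma>\<in>?P. ?G \<sigma> i * h (\<sigma> j) i) = (\<Sum>j=Suc t..n. \<Sum>\<sigma>\<in>?P. ?G \<sigma> i * h (\<sigma> (Suc t)) i)"
        by (intro sum.cong refl swap)
      then show ?thesis by (simp only: sum_constant card_atLeastAtMost diff_Suc_Suc)
    qed
    also have "\<dots> = (\<Sum>\<sigma>\<in>?P. ?G \<sigma> i * (\<Sum>j=Suc t..n. h (\<sigma> j) i))"
      by (subst sum.swap) (simp only: sum_distrib_left)
    also have "\<dots> = (\<Sum>\<sigma>\<in>?P. ?G \<sigma> i * (?q * tail_mean n h (Suc t) \<sigma> i))"
      using q by (simp add: tail_mean_def)
    also have "\<dots> = ?q * (\<Sum>\<sigma>\<in>?P. ?G \<sigma> i * tail_mean n h (Suc t) \<sigma> i)"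
      by (simp only: sum_distrib_left mult.left_commute)
    finally show ?thesis using q by simp
  qed
  have "(\<Sum>\<sigma>\<in>?P. ?\<Phi> (Suc t) \<sigma> / ?D (Suc t) \<sigma>)
      \<le> (\<Sum>\<sigma>\<in>?P. (?\<Phi> t \<sigma> + c * (\<Sum>i\<in>I. w t \<sigma> i * h (\<sigma> (Suc t)) i)) / ?D (Suc t) \<sigma>)"
    using Suc.prems D[of _ "Suc t"] by (intro sum_mono divide_right_mono w_step) (auto simp: less_imp_le)
  also have "\<dots> = (\<Sum>\<sigma>\<in>?P. ?\<Phi> t \<sigma> / ?D (Suc t) \<sigma>) + c * (\<Sum>i\<in>I. \<Sum>\<sigma>\<in>?P. ?G \<sigma> i * h (\<sigma> (Suc t)) i)"
    by (subst sum.swap)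
      (simp add: add_divide_distrib sum.distrib sum_distrib_left sum_divide_distrib mult_ac)
  \<comment> \<open>The maximum bounds all rows at once, so it factors out of the sum over
    \<open>i\<close> and then cancels the newest factor of \<open>?D (Suc t)\<close>.\<close>
  also have "\<dots> \<le> (\<Sum>\<sigma>\<in>?P. ?\<Phi> t \<sigma> / ?D (Suc t) \<sigma>) + c * (\<Sum>i\<in>I. \<Sum>\<sigma>\<in>?P. ?G \<sigma> i * ?\<rho> \<sigma>)"
    unfolding mean using c
    by (intro add_left_mono mult_left_mono sum_mono tail_mean_le_tail_max I G0)
  also have "\<dots> = (\<Sum>\<sigma>\<in>?P. ?\<Phi> t \<sigma> / ?D (Suc t) \<sigma> * (1 + c * ?\<rho> \<sigma>))"
  proof -
    have "(\<Sum>i\<in>I. \<Sum>\<sigma>\<in>?P. ?G \<sigma> i * ?\<rho> \<sigma>) = (\<Sum>\<sigma>\<in>?P. ?\<Phi> t \<sigma> / ?D (Suc t) \<sigma> * ?\<rho> \<sigma>)"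
      by (subst sum.swap) (simp only: sum_distrib_right sum_divide_distrib)
    then show ?thesis
      by (simp only: distrib_left mult_1_right sum.distrib sum_distrib_left mult.left_commute)
  qed
  also have "\<dots> = (\<Sum>\<sigma>\<in>?P. ?\<Phi> t \<sigma> / ?D t \<sigma>)"
  proof (intro sum.cong refl)
    fix \<sigma> assume "\<sigma> \<in> ?P"
    then have "1 + c * ?\<rho> \<sigma> \<noteq> 0" using Dfac[of \<sigma> "Suc t"] by simp
    then show "?\<Phi> t \<sigma> / ?D (Suc t) \<sigma> * (1 + c * ?\<rho> \<sigma>) = ?\<Phi> t \<sigma> / ?D t \<sigma>"
      by simp
  qed
  finally show ?case using Suc by simp
qed

section \<open>Exponential moments and deviations of the tail means\<close>

text \<open>The factor \<open>n + 1 - t\<close> in \<open>\<kappa>\<close> cancels the divisor of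
  the mean, so the exponential is a product of \<open>exp (\<theta> / g * h u i)\<close> over the
  tail. Maclaurin's inequality reduces it to one average, bounded by the chord and
  \<open>exp \<theta> \<le> 1 + \<theta> + \<theta>\<^sup>2\<close>.\<close>

lemma sum_permutes_exp_tail_mean_le:
  fixes h :: "nat \<Rightarrow> 'i \<Rightarrow> real"
  assumes t: "1 \<le> t" "t \<le> n" and g: "0 < g" and \<theta>: "0 \<le> \<theta>" "\<theta> \<le> 1"
    and h: "\<And>u. u \<in> {1..n} \<Longrightarrow> 0 \<le> h u i \<and> h u i \<le> g" and hsum: "(\<Sum>u=1..n. h u i) \<le> 1"
  defines "\<kappa> \<equiv> \<theta> * real (n + 1 - t) / g"
  shows "(\<Sum>\<sigma> | \<sigma> permutes {1..n}. exp (\<kappa> * tail_mean n h t \<sigma> i)) \<le> fact n * exp (\<kappa> * ((1 + \<theta>) / n))"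
proof -
  let ?P = "{\<sigma>. \<sigma> permutes {1..n}}"
  let ?f = "\<lambda>u. exp (\<theta> / g * h u i)"
  let ?q = "n + 1 - t"
  have q: "real ?q > 0" and n: "real n > 0" using t by auto
  have e\<theta>: "exp \<theta> - 1 \<le> \<theta> + \<theta>\<^sup>2" using exp_bound[of \<theta>] \<theta> by simp
  have "(\<Sum>u=1..n. ?f u) \<le> (\<Sum>u=1..n. 1 + (exp \<theta> - 1) / g * h u i)"
    using exp_chord_le[of "h _ i" g "\<theta> / g"] h g by (intro sum_mono) auto
  also have "\<dots> = n + (exp \<theta> - 1) / g * (\<Sum>u=1..n. h u i)"
    by (simp add: sum.distrib sum_distrib_left)
  also have "\<dots> \<le> n + (\<theta> + \<theta>\<^sup>2) / g * 1"
    using e\<theta> g \<theta> h hsum by (intro add_left_mono mult_mono divide_right_mono sum_nonneg) auto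
  finally have "(\<Sum>u=1..n. ?f u) / n \<le> 1 + (\<theta> + \<theta>\<^sup>2) / (g * n)"
    using n g by (simp add: field_simps)
  also have "\<dots> \<le> exp ((\<theta> + \<theta>\<^sup>2) / (g * n))" by simp
  finally have mean: "(\<Sum>u=1..n. ?f u) / n \<le> exp ((\<theta> + \<theta>\<^sup>2) / (g * n))" .
  have "exp (\<kappa> * tail_mean n h t \<sigma> i) = (\<Prod>j=t..n. ?f (\<sigma> j))" for \<sigma>
  proof -
    have "\<kappa> * tail_mean n h t \<sigma> i = (\<Sum>j=t..n. \<theta> / g * h (\<sigma> j) i)"
      using q unfolding \<kappa>_def tail_mean_def by (simp flip: sum_distrib_left sum_divide_distrib)
    then show ?thesis by (simp add: exp_sum)
  qed
  then have "(\<Sum>\<sigma>\<in>?P. exp (\<kappa> * tail_mean n h t \<sigma> i)) \<le> fact n * ((\<Sum>u=1..n. ?f u) / n) ^ ?q"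
    using sum_permutes_prod_le[of "{1..n}" "{t..n}" ?f] t by simp
  also have "\<dots> \<le> fact n * exp ((\<theta> + \<theta>\<^sup>2) / (g * n)) ^ ?q"
    by (intro mult_left_mono power_mono mean divide_nonneg_nonneg sum_nonneg) auto
  also have "\<dots> = fact n * exp (?q * ((\<theta> + \<theta>\<^sup>2) / (g * n)))"
    by (simp flip: exp_of_nat_mult)
  also have "?q * ((\<theta> + \<theta>\<^sup>2) / (g * n)) = \<kappa> * ((1 + \<theta>) / n)"
    by (simp add: \<kappa>_def power2_eq_square algebra_simps)
  finally show ?thesis .
qed

text \<open>Since \<open>e\<^sup>x \<ge> 1 + x\<close>, the weights \<open>1 / l t\<close> reduce the deviation of a sum of maxima to the
  exponential moments of the single terms, with no union bound over \<open>t\<close>.\<close>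
lemma card_sum_tail_max_gt_le:
  fixes s l :: "nat \<Rightarrow> real"
  assumes I: "finite I" "I \<noteq> {}" and l: "\<And>t. t \<in> {1..T} \<Longrightarrow> 0 < l t" and T: "0 < T"
    and moment: "\<And>t i. t \<in> {1..T} \<Longrightarrow> i \<in> I \<Longrightarrow>
      (\<Sum>\<sigma> | \<sigma> permutes {1..n}. exp (l t * (tail_mean n h t \<sigma> i - s t))) \<le> fact n * (\<delta> / card I)"
  shows "real (card {\<sigma>. \<sigma> permutes {1..n} \<and> (\<Sum>t=1..T. s t) < (\<Sum>t=1..T. tail_max I n h t \<sigma>)}) \<le> fact n * \<delta>"
proof -
  let ?P = "{\<sigma>. \<sigma> permutes {1..n}}"
  let ?r = "tail_mean n h" and ?\<rho> = "tail_max I n h"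
  let ?W = "\<Sum>t=1..T. 1 / l t"
  let ?X = "\<lambda>\<sigma>. \<Sum>t=1..T. 1 / l t * exp (l t * (?\<rho> t \<sigma> - s t))"
  have fP: "finite ?P" by (simp add: finite_permutations)
  have W: "0 < ?W" using l T by (intro sum_pos) auto
  have cI: "real (card I) > 0" using I by (simp add: card_gt_0_iff)
  have X0: "0 \<le> ?X \<sigma>" for \<sigma> using l by (intro sum_nonneg mult_nonneg_nonneg) (auto simp: less_imp_le)
  have X: "?W + ((\<Sum>t=1..T. ?\<rho> t \<sigma>) - (\<Sum>t=1..T. s t)) \<le> ?X \<sigma>" for \<sigma>
  proof -
    have "?W + ((\<Sum>t=1..T. ?\<rho> t \<sigma>) - (\<Sum>t=1..T. s t))
        = (\<Sum>t=1..T. 1 / l t + (?\<rho> t \<sigma> - s t))"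
      by (simp add: sum.distrib sum_subtractf)
    also have "\<dots> = (\<Sum>t=1..T. 1 / l t * (1 + l t * (?\<rho> t \<sigma> - s t)))"
      using l by (intro sum.cong refl) (fastforce simp: distrib_left)
    also have "\<dots> \<le> ?X \<sigma>"
      using l by (intro sum_mono mult_left_mono exp_ge_add_one_self) (auto simp: less_imp_le)
    finally show ?thesis .
  qed
  \<comment> \<open>The maximum is attained at some row, so its exponential is at most the sum over
    rows; this costs the factor \<open>card I\<close> provided for in \<open>moment\<close>.\<close>
  have "exp (l t * (?\<rho> t \<sigma> - s t)) \<le> (\<Sum>i\<in>I. exp (l t * (?r t \<sigma> i - s t)))" for t \<sigma>
  proof -
    obtain i where i: "i \<in> I" "?\<rho> t \<sigma> = ?r t \<sigma> i" using tail_max_eq[OF I] by metis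
    then show ?thesis
      using member_le_sum[of i I "\<lambda>i. exp (l t * (?r t \<sigma> i - s t))"] I by simp
  qed
  then have "(\<Sum>\<sigma>\<in>?P. exp (l t * (?\<rho> t \<sigma> - s t)))
      \<le> (\<Sum>\<sigma>\<in>?P. \<Sum>i\<in>I. exp (l t * (?r t \<sigma> i - s t)))" for t
    by (intro sum_mono)
  also have "(\<Sum>\<sigma>\<in>?P. \<Sum>i\<in>I. exp (l t * (?r t \<sigma> i - s t))) \<le> fact n * \<delta>" if "t \<in> {1..T}" for t
  proof -
    have "(\<Sum>\<sigma>\<in>?P. \<Sum>i\<in>I. exp (l t * (?r t \<sigma> i - s t))) \<le> (\<Sum>i\<in>I. fact n * (\<delta> / card I))"
      using that by (subst sum.swap) (intro sum_mono moment)
    then show ?thesis using cI by simp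
  qed
  finally have max_moment: "(\<Sum>\<sigma>\<in>?P. exp (l t * (?\<rho> t \<sigma> - s t))) \<le> fact n * \<delta>" if "t \<in> {1..T}" for t
    using that by simp
  \<comment> \<open>Markov with threshold \<open>?W\<close>: the mean of \<open>?X\<close> is at
    most \<open>\<delta> * ?W\<close>, so the weights cancel.\<close>
  have "real (card {\<sigma> \<in> ?P. ?W < ?X \<sigma>}) * ?W \<le> (\<Sum>\<sigma>\<in>?P. ?X \<sigma>)"
    using fP X0 by (rule card_gt_mult_le_sum)
  also have "\<dots> = (\<Sum>t=1..T. 1 / l t * (\<Sum>\<sigma>\<in>?P. exp (l t * (?\<rho> t \<sigma> - s t))))"
    by (subst sum.swap) (simp add: sum_distrib_left)
  also have "\<dots> \<le> (\<Sum>t=1..T. 1 / l t * (fact n * \<delta>))"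
    using l by (intro sum_mono mult_left_mono max_moment) (auto simp: less_imp_le)
  also have "\<dots> = fact n * \<delta> * ?W"
    by (simp add: sum_distrib_left)
  finally have "real (card {\<sigma> \<in> ?P. ?W < ?X \<sigma>}) \<le> fact n * \<delta>"
    using W by simp
  moreover have "card {\<sigma>. \<sigma> permutes {1..n} \<and> (\<Sum>t=1..T. s t) < (\<Sum>t=1..T. ?\<rho> t \<sigma>)} \<le> card {\<sigma> \<in> ?P. ?W < ?X \<sigma>}"
  proof (rule card_mono)
    show "finite {\<sigma> \<in> ?P. ?W < ?X \<sigma>}" using fP by simp
    show "{\<sigma>. \<sigma> permutes {1..n} \<and> (\<Sum>t=1..T. s t) < (\<Sum>t=1..T. ?\<rho> t \<sigma>)} \<subseteq> {\<sigma> \<in> ?P. ?W < ?X \<sigma>}"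
      using X by (smt (verit) Collect_mono mem_Collect_eq)
  qed
  ultimately show ?thesis by linarith
qed

section \<open>The run of the algorithm and its loads\<close>

lemma length_alg_run [simp]: "length (alg_run rule A \<sigma> t) = t"
  by (induction t) (auto simp: Let_def)

lemma alg_run_nth:
  assumes "s < t" "t \<le> n"
  shows "alg_run rule A \<sigma> n ! s = alg_run rule A \<sigma> t ! s"
  using assms(2,1) by (induction n rule: dec_induct) (auto simp: Let_def nth_append)

lemma alg_run_cong:
  assumes "\<And>s. s \<in> {1..t} \<Longrightarrow> \<sigma> s = \<tau> s"
  shows "alg_run rule A \<sigma> t = alg_run rule A \<tau> t"
  using assms
proof (induction t)
  case (Suc t)
  have "map (\<lambda>s. A (\<sigma> s)) [1..<t + 2] = map (\<lambda>s. A (\<tau> s)) [1..<t + 2]"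
    using Suc.prems by (intro map_cong) auto
  moreover have "alg_run rule A \<sigma> t = alg_run rule A \<tau> t" using Suc by simp
  ultimately show ?case by (simp only: alg_run.simps)
qed simp

text \<open>Steps count from 1 and list positions from 0, hence \<open>s - 1\<close>. The run of
  length \<open>t\<close> is used so that the load visibly depends on the first \<open>t\<close>
  steps only.\<close>

definition alg_load where
  "alg_load k rule A \<sigma> t i = (\<Sum>s=1..t. matvec k (A (\<sigma> s)) (alg_run rule A \<sigma> t ! (s - 1)) i)"

text \<open>The algorithm is online; this supplies the adaptedness required by the supermartingale
  bound.\<close>

lemma alg_load_cong:
  assumes "\<And>s. s \<in> {1..t} \<Longrightarrow> \<sigma> s = \<tau> s"
  shows "alg_load k rule A \<sigma> t i = alg_load k rule A \<tau> t i"
  unfolding alg_load_def using assms alg_run_cong[OF assms] by (intro sum.cong) auto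

lemma alg_load_Suc:
  "alg_load k rule A \<sigma> (Suc t) i = alg_load k rule A \<sigma> t i
    + matvec k (A (\<sigma> (Suc t))) (rule (map (\<lambda>s. A (\<sigma> s)) [1..<t + 2]) (alg_run rule A \<sigma> t)) i"
proof -
  have "alg_run rule A \<sigma> (Suc t) ! (s - 1) = alg_run rule A \<sigma> t ! (s - 1)" if "s \<in> {1..t}" for s
    using that by (intro alg_run_nth) auto
  then show ?thesis
    by (simp add: alg_load_def Let_def nth_append del: upt_Suc)
qed

lemma alg_obj_alg_run:
  "alg_obj m k \<nu> (map (\<lambda>s. A (\<sigma> s)) [1..<t + 2]) (alg_run rule A \<sigma> t) z
    = (\<Sum>i<m. exp (\<nu> * alg_load k rule A \<sigma> t i) * matvec k (A (\<sigma> (Suc t))) z i)"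
proof -
  let ?Ms = "map (\<lambda>s. A (\<sigma> s)) [1..<t + 2]"
  \<comment> \<open>The list runs over \<open>1, \<dots>, t + 1\<close>: one matrix more than there
    are previous choices.\<close>
  have "last ?Ms = A (\<sigma> (Suc t))" by simp
  moreover have "(\<Sum>s<t. matvec k (?Ms ! s) (alg_run rule A \<sigma> t ! s) i) = alg_load k rule A \<sigma> t i" for i
    unfolding alg_load_def
    by (rule sum.reindex_bij_witness[of _ "\<lambda>s. s - 1" Suc]) (auto simp del: upt_Suc)
  ultimately show ?thesis by (simp add: alg_obj_def del: upt_Suc)
qed

lemma matvec_simplex_bounds:
  assumes "z \<in> simplex k" "\<And>j. j < k \<Longrightarrow> 0 \<le> M i j \<and> M i j \<le> g"
  shows "0 \<le> matvec k M z i" "matvec k M z i \<le> g"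
proof -
  have z: "0 \<le> z j" if "j < k" for j using assms(1) that by (simp add: simplex_def)
  show "0 \<le> matvec k M z i"
    unfolding matvec_def using z assms(2) by (intro sum_nonneg mult_nonneg_nonneg) auto
  have "matvec k M z i \<le> (\<Sum>j<k. g * z j)"
    unfolding matvec_def using z assms(2) by (intro sum_mono mult_right_mono) auto
  also have "\<dots> = g"
    using assms(1) by (simp add: simplex_def flip: sum_distrib_left)
  finally show "matvec k M z i \<le> g" .
qed

text \<open>The chord bound makes the growth of the potential linear in the chosen point, with
  exactly the objective that the algorithm minimizes; any \<open>y\<close> in the simplex can then
  replace the choice.\<close>

lemma alg_potential_step:
  fixes A :: "nat \<Rightarrow> nat \<Rightarrow> nat \<Rightarrow> real"
  assumes A: "\<And>i j. i < m \<Longrightarrow> j < k \<Longrightarrow> 0 \<le> A (\<sigma> (Suc t)) i j \<and> A (\<sigma> (Suc t)) i j \<le> \<gamma>"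
    and pos: "0 < \<gamma>" "0 \<le> \<epsilon>"
    and rule: "\<And>Ms xs. length Ms = length xs + 1 \<Longrightarrow> is_argmin_step m k (ln (1 + \<epsilon>) / \<gamma>) Ms xs (rule Ms xs)"
    and y: "y \<in> simplex k"
  defines "w \<equiv> \<lambda>t i. exp (ln (1 + \<epsilon>) / \<gamma> * alg_load k rule A \<sigma> t i)"
  shows "(\<Sum>i<m. w (Suc t) i) \<le> (\<Sum>i<m. w t i) + \<epsilon> / \<gamma> * (\<Sum>i<m. w t i * matvec k (A (\<sigma> (Suc t))) y i)"
proof -
  let ?Ms = "map (\<lambda>s. A (\<sigma> s)) [1..<t + 2]" and ?xs = "alg_run rule A \<sigma> t"
  let ?M = "A (\<sigma> (Suc t))" and ?\<nu> = "ln (1 + \<epsilon>) / \<gamma>"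
  let ?x = "rule ?Ms ?xs"
  have opt: "is_argmin_step m k ?\<nu> ?Ms ?xs ?x"
    by (rule rule) (simp del: upt_Suc)
  have x: "?x \<in> simplex k" using opt by (simp add: is_argmin_step_def)
  have e: "exp (?\<nu> * \<gamma>) = 1 + \<epsilon>" using pos by simp
  have "(\<Sum>i<m. w (Suc t) i) \<le> (\<Sum>i<m. w t i * (1 + \<epsilon> / \<gamma> * matvec k ?M ?x i))"
  proof (intro sum_mono)
    fix i assume i: "i \<in> {..<m}"
    then have "exp (?\<nu> * matvec k ?M ?x i) \<le> 1 + \<epsilon> / \<gamma> * matvec k ?M ?x i"
      using exp_chord_le[OF matvec_simplex_bounds[OF x, of ?M i \<gamma>] pos(1), of ?\<nu>] A e by simp
    then show "w (Suc t) i \<le> w t i * (1 + \<epsilon> / \<gamma> * matvec k ?M ?x i)"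
      unfolding w_def alg_load_Suc distrib_left[of ?\<nu>] exp_add by (rule mult_left_mono) simp
  qed
  also have "\<dots> = (\<Sum>i<m. w t i) + \<epsilon> / \<gamma> * (\<Sum>i<m. w t i * matvec k ?M ?x i)"
    by (simp add: distrib_left sum.distrib sum_distrib_left mult_ac)
  also have "(\<Sum>i<m. w t i * matvec k ?M ?x i) \<le> (\<Sum>i<m. w t i * matvec k ?M y i)"
    using opt y unfolding is_argmin_step_def alg_obj_alg_run w_def by blast
  finally show ?thesis using pos by (simp add: mult_left_mono divide_right_mono)
qed

section \<open>Choice of parameters and combination of the two bad events\<close>

theorem theorem1:
  fixes m k n :: nat
    and A :: "nat \<Rightarrow> nat \<Rightarrow> nat \<Rightarrow> real"
    and xstar :: "nat \<Rightarrow> nat \<Rightarrow> real"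
    and \<gamma> \<epsilon> \<nu> :: real
    and T :: nat
    and rule :: "(nat \<Rightarrow> nat \<Rightarrow> real) list \<Rightarrow> (nat \<Rightarrow> real) list \<Rightarrow> (nat \<Rightarrow> real)"
  assumes "0 < m" "0 < k" "0 < n"
    and A_nonneg: "\<And>t i j. t \<in> {1..n} \<Longrightarrow> i < m \<Longrightarrow> j < k \<Longrightarrow> 0 \<le> A t i j"
    and xstar_simplex: "\<And>t. t \<in> {1..n} \<Longrightarrow> xstar t \<in> simplex k"
    and xstar_feasible: "\<And>i. i < m \<Longrightarrow> (\<Sum>t=1..n. matvec k (A t) (xstar t) i) \<le> 1"
    and gamma_def: "\<gamma> = Max {A t i j | t i j. t \<in> {1..n} \<and> i < m \<and> j < k}"
    and gamma_pos: "0 < \<gamma>"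
    and eps: "0 < \<epsilon>" "\<epsilon> < 1"
    and log_int: "\<exists>l::int. log 2 (1 / \<epsilon>) = real_of_int l"
    and neps_int: "\<exists>N::nat. real n * \<epsilon> = real N"
    and T_def: "real T = real n * (1 - \<epsilon>)"
    and nu_def: "\<nu> = ln (1 + \<epsilon>) / \<gamma>"
    and rule_argmin: "\<And>Ms xs. length Ms = length xs + 1 \<Longrightarrow> is_argmin_step m k \<nu> Ms xs (rule Ms xs)"
    and eps_small: "\<epsilon> \<le> 1 / 4"
    and gamma_small: "\<gamma> \<le> \<epsilon>\<^sup>2 / (12 * ln (real m / \<epsilon>))"
  shows "real (card {\<sigma>. \<sigma> permutes {1..n} \<and>
            Max {(\<Sum>s=1..T. matvec k (A (\<sigma> s)) (alg_run rule A \<sigma> n ! (s - 1)) i) | i. i < m}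
              > 1 + 2 * \<epsilon>}) / real (fact n) \<le> \<epsilon>"
proof -
  let ?P = "{\<sigma>. \<sigma> permutes {1..n}}" and ?I = "{..<m}"
  define h where "h u i = matvec k (A u) (xstar u) i" for u i
  define w where "w t \<sigma> i = exp (\<nu> * alg_load k rule A \<sigma> t i)" for t \<sigma> i
  \<comment> \<open>The slope of the chord of \<open>exp (\<nu> * a)\<close> over
    \<open>[0, \<gamma>]\<close>, as \<open>exp (\<nu> * \<gamma>) = 1 + \<epsilon>\<close>.\<close>
  define c where "c = \<epsilon> / \<gamma>"
  \<comment> \<open>One \<open>L\<close> serves both events: \<open>exp L\<close> is the Markov
    threshold for the potential, and \<open>exp (- L)\<close> is the moment allowed per row when
    \<open>m\<close> rows together may cost \<open>\<epsilon> / 2\<close>.\<close>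
  define L where "L = ln (2 * m / \<epsilon>)"
  define q where "q t = real (n + 1 - t)" for t
  \<comment> \<open>\<open>\<theta>\<close> balances the two error terms \<open>\<theta> t / n\<close> and \<open>L / l t\<close> of \<open>s t\<close>.\<close>
  define \<theta> where "\<theta> t = \<epsilon> / 2 * sqrt (n / q t)" for t
  \<comment> \<open>\<open>l t\<close> is the exponent \<open>\<kappa>\<close> of the moment bound,
    and \<open>s t\<close> is chosen so that this bound becomes \<open>exp (- L)\<close>.\<close>
  define l where "l t = \<theta> t * q t / \<gamma>" for t
  define s where "s t = (1 + \<theta> t) / n + L / l t" for t
  let ?\<rho> = "tail_max ?I n h"
  let ?D = "\<lambda>\<sigma>. \<Prod>t=1..T. 1 + c * ?\<rho> t \<sigma>"
  have I: "finite ?I" "?I \<noteq> {}" using \<open>0 < m\<close> by (auto simp: lessThan_empty_iff)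
  have n: "real n > 0" and m: "real m \<ge> 1" using \<open>0 < n\<close> \<open>0 < m\<close> by auto
  have c: "0 < c" using eps gamma_pos by (simp add: c_def)
  have T0: "0 < T" using T_def n eps by (metis mult_pos_pos diff_gt_0_iff_gt of_nat_0_less_iff)
  have "real T \<le> real n" unfolding T_def using eps n by (simp add: mult_left_le)
  then have Tn: "T \<le> n" by simp
  have fin: "finite {A t i j | t i j. t \<in> {1..n} \<and> i < m \<and> j < k}"
  proof (rule finite_subset)
    show "{A t i j | t i j. t \<in> {1..n} \<and> i < m \<and> j < k}
        \<subseteq> (\<lambda>(t, i, j). A t i j) ` ({1..n} \<times> {..<m} \<times> {..<k})" by force
  qed simp
  have A: "0 \<le> A t i j \<and> A t i j \<le> \<gamma>" if "t \<in> {1..n}" "i < m" "j < k" for t i j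
    
  proof
    show "A t i j \<le> \<gamma>" unfolding gamma_def using that by (intro Max_ge[OF fin]) blast
  qed (rule A_nonneg[OF that])
  have h: "0 \<le> h u i \<and> h u i \<le> \<gamma>" if "u \<in> {1..n}" "i \<in> ?I" for u i
    unfolding h_def using matvec_simplex_bounds[OF xstar_simplex, of u "A u" i \<gamma>] A that by simp

  have ln2: "0 < ln (2::real)" by simp
  \<comment> \<open>From \<open>m \<ge> 1\<close> and \<open>\<epsilon> \<le> 1 / 4\<close>. It
    makes \<open>L\<close> at most \<open>3 / 2 * ln (m / \<epsilon>)\<close>, and the constant 12
    then gives \<open>\<gamma> * L \<le> \<epsilon>\<^sup>2 / 8\<close>.\<close>
  have "ln 4 \<le> ln (m / \<epsilon>)"
    using m eps eps_small by (subst ln_le_cancel_iff) (auto simp: field_simps)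
  then have lnm: "2 * ln 2 \<le> ln (m / \<epsilon>)"
    using ln_realpow[of 2 2] by simp
  with ln2 have lnm0: "0 < ln (m / \<epsilon>)" by linarith
  have Leq: "L = ln 2 + ln (m / \<epsilon>)"
    unfolding L_def using m eps by (simp add: ln_mult flip: times_divide_eq_right)
  have "\<gamma> * L \<le> \<gamma> * (3 / 2 * ln (m / \<epsilon>))"
    using lnm lnm0 gamma_pos Leq by (intro mult_left_mono) auto
  also have "\<dots> \<le> \<epsilon>\<^sup>2 / 8"
    using gamma_small lnm0 by (simp add: field_simps)
  finally have \<gamma>L: "\<gamma> * L \<le> \<epsilon>\<^sup>2 / 8" .
  have L0: "0 \<le> L" using Leq lnm0 ln2 by linarith
  have expL: "exp L = 2 * m / \<epsilon>" unfolding L_def using m eps by simp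

  \<comment> \<open>Stopping at \<open>T\<close> keeps a fraction \<open>\<epsilon>\<close> of the
    indices unrevealed, which keeps \<open>\<theta> t\<close> below 1.\<close>
  have q: "n * \<epsilon> \<le> q t" if "t \<in> {1..T}" for t
    using that Tn T_def by (simp add: q_def of_nat_diff algebra_simps)
  then have q0: "0 < q t" if "t \<in> {1..T}" for t
    using that n eps by (meson less_le_trans mult_pos_pos)
  have \<theta>: "0 < \<theta> t" "\<theta> t \<le> 1" if t: "t \<in> {1..T}" for t
  proof -
    show "0 < \<theta> t" using q0[OF t] n eps by (simp add: \<theta>_def)
    have "\<epsilon> * sqrt (n / q t) \<le> \<epsilon> * sqrt (1 / \<epsilon>)"
      using q[OF t] q0[OF t] eps by (intro mult_left_mono real_sqrt_le_mono) (auto simp: field_simps)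
    also have "\<dots> = sqrt \<epsilon>"
      using eps by (simp add: real_sqrt_divide real_div_sqrt)
    also have "\<dots> \<le> 1" using eps by simp
    finally show "\<theta> t \<le> 1" by (simp add: \<theta>_def)
  qed
  have l: "0 < l t" if "t \<in> {1..T}" for t
    using \<theta>[OF that] q0[OF that] gamma_pos by (simp add: l_def)

  have moment: "(\<Sum>\<sigma>\<in>?P. exp (l t * (tail_mean n h t \<sigma> i - s t))) \<le> fact n * (\<epsilon> / 2 / card ?I)"
    if t: "t \<in> {1..T}" and i: "i \<in> ?I" for t i
  proof -
    have ls: "l t * s t = l t * ((1 + \<theta> t) / n) + L"
      using l[OF t] by (simp add: s_def distrib_left)
    have "(\<Sum>\<sigma>\<in>?P. exp (l t * (tail_mean n h t \<sigma> i - s t)))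
        = (\<Sum>\<sigma>\<in>?P. exp (l t * tail_mean n h t \<sigma> i)) * exp (- (l t * s t))"
      by (simp add: right_diff_distrib exp_diff exp_minus sum_divide_distrib divide_inverse sum_distrib_right)
    also have "\<dots> \<le> fact n * exp (l t * ((1 + \<theta> t) / n)) * exp (- (l t * s t))"
      unfolding l_def q_def
      using sum_permutes_exp_tail_mean_le[of t n \<gamma> "\<theta> t" h i] t Tn gamma_pos \<theta>[OF t] h i xstar_feasible
      by (intro mult_right_mono) (auto simp: h_def)
    also have "\<dots> = fact n * exp (- L)"
      unfolding mult.assoc ls by (simp flip: exp_add)
    also have "\<dots> = fact n * (\<epsilon> / 2 / card ?I)"
      using expL by (simp add: exp_minus)
    finally show ?thesis .
  qed
  have bad_tail: "real (card {\<sigma>. \<sigma> permutes {1..n} \<and> (\<Sum>t=1..T. s t) < (\<Sum>t=1..T. ?\<rho> t \<sigma>)})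
      \<le> fact n * (\<epsilon> / 2)"
    using I l T0 moment by (rule card_sum_tail_max_gt_le)

  \<comment> \<open>The \<open>3 / 4\<close> is \<open>1 / 2\<close> from
    \<open>\<theta> t / n\<close> plus \<open>1 / 4\<close> from \<open>L / l t\<close>.\<close>
  have "s t \<le> 1 / n + 3 / 4 * \<epsilon> / sqrt n * (1 / sqrt (q t))" if t: "t \<in> {1..T}" for t
  proof -
    have "\<theta> t / n = \<epsilon> / 2 / sqrt n * (1 / sqrt (q t))"
      using n q0[OF t] by (simp add: \<theta>_def real_sqrt_divide field_simps flip: power2_eq_square)
    moreover have "L / l t \<le> \<epsilon> / 4 / sqrt n * (1 / sqrt (q t))"
    proof -
      have "\<theta> t * q t = \<epsilon> / 2 * (sqrt n * sqrt (q t))"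
      proof -
        have "\<theta> t * q t = \<epsilon> / 2 * (sqrt n * (q t / sqrt (q t)))"
          by (simp add: \<theta>_def real_sqrt_divide)
        then show ?thesis using q0[OF t] by (simp add: real_div_sqrt)
      qed
      then have "L / l t = \<gamma> * L / (\<epsilon> / 2 * (sqrt n * sqrt (q t)))"
        unfolding l_def by (simp only:) simp
      also have "\<dots> \<le> \<epsilon>\<^sup>2 / 8 / (\<epsilon> / 2 * (sqrt n * sqrt (q t)))"
        using \<gamma>L q0[OF t] eps by (intro divide_right_mono) auto
      also have "\<dots> = \<epsilon> / 4 / sqrt n * (1 / sqrt (q t))"
        using eps by (simp add: power2_eq_square)
      finally show ?thesis .
    qed
    ultimately show ?thesis
      unfolding s_def add_divide_distrib by (simp add: field_simps)
  qed
  then have "(\<Sum>t=1..T. s t) \<le> (\<Sum>t=1..T. 1 / n + 3 / 4 * \<epsilon> / sqrt n * (1 / sqrt (q t)))"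
    by (intro sum_mono)
  also have "\<dots> = T / n + 3 / 4 * \<epsilon> / sqrt n * (\<Sum>t=1..T. 1 / sqrt (q t))"
    by (simp only: sum.distrib sum_distrib_left) simp
  also have "\<dots> \<le> T / n + 3 / 4 * \<epsilon> / sqrt n * (2 * sqrt n)"
  proof (intro add_left_mono mult_left_mono)
    show "(\<Sum>t=1..T. 1 / sqrt (q t)) \<le> 2 * sqrt n"
      unfolding q_def by (rule order_trans[OF sum_inverse_sqrt_le[OF Tn]]) simp
  qed (use eps in auto)
  \<comment> \<open>Here \<open>T / n = 1 - \<epsilon>\<close>, and the deviations add
    \<open>3 / 2 * \<epsilon>\<close>.\<close>
  also have "\<dots> = 1 + \<epsilon> / 2"
    using T_def n by simp
  finally have S: "(\<Sum>t=1..T. s t) \<le> 1 + \<epsilon> / 2" .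

  have D: "0 < ?D \<sigma>" "?D \<sigma> \<le> exp (c * (\<Sum>t=1..T. ?\<rho> t \<sigma>))" if \<sigma>: "\<sigma> \<in> ?P" for \<sigma>
  proof -
    have \<rho>0: "0 \<le> ?\<rho> t \<sigma>" if "1 \<le> t" for t
      using tail_max_nonneg[OF I, of \<sigma> n t h] that \<sigma> h by simp
    show "0 < ?D \<sigma>" using \<rho>0 c by (intro prod_pos) (simp add: add_pos_nonneg)
    have "?D \<sigma> \<le> (\<Prod>t=1..T. exp (c * ?\<rho> t \<sigma>))"
      using \<rho>0 c by (intro prod_mono) simp
    then show "?D \<sigma> \<le> exp (c * (\<Sum>t=1..T. ?\<rho> t \<sigma>))" by (simp add: exp_sum sum_distrib_left)
  qed
  let ?Z = "\<lambda>\<sigma>. (\<Sum>i\<in>?I. w T \<sigma> i) / ?D \<sigma>"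
  have "(\<Sum>\<sigma>\<in>?P. ?Z \<sigma>) \<le> fact n * card ?I"
  proof (rule sum_permutes_potential_le[OF I _ Tn])
    fix t \<sigma> assume t: "t < n" and \<sigma>: "\<sigma> permutes {1..n}"
    have u: "\<sigma> (Suc t) \<in> {1..n}" using t permutes_in_image[OF \<sigma>, of "Suc t"] by simp
    show "(\<Sum>i\<in>?I. w (Suc t) \<sigma> i) \<le> (\<Sum>i\<in>?I. w t \<sigma> i) + c * (\<Sum>i\<in>?I. w t \<sigma> i * h (\<sigma> (Suc t)) i)"
      unfolding w_def c_def h_def nu_def
      using A[OF u] gamma_pos eps rule_argmin xstar_simplex[OF u]
      by (intro alg_potential_step) (auto simp: nu_def)
  next
    fix t i and \<sigma> \<tau> :: "nat \<Rightarrow> nat" assume "\<And>s. s \<in> {1..t} \<Longrightarrow> \<sigma> s = \<tau> s"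
    then show "w t \<sigma> i = w t \<tau> i" unfolding w_def using alg_load_cong[of t \<sigma> \<tau>] by simp
  qed (use c h in \<open>auto simp: w_def alg_load_def\<close>)
  moreover have "real (card {\<sigma> \<in> ?P. 2 * m / \<epsilon> < ?Z \<sigma>}) * (2 * m / \<epsilon>) \<le> (\<Sum>\<sigma>\<in>?P. ?Z \<sigma>)"
    using D by (intro card_gt_mult_le_sum divide_nonneg_nonneg sum_nonneg)
      (auto simp: w_def finite_permutations less_imp_le)
  ultimately have "real (card {\<sigma> \<in> ?P. 2 * m / \<epsilon> < ?Z \<sigma>}) * (2 * m / \<epsilon>) \<le> fact n * m"
    by simp
  then have bad_Z: "real (card {\<sigma> \<in> ?P. 2 * m / \<epsilon> < ?Z \<sigma>}) \<le> fact n * (\<epsilon> / 2)"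
    using m eps by (simp add: field_simps)

  \<comment> \<open>Off both bad events the bound is deterministic: one row's weight is at most the
    whole potential, and taking logarithms bounds its load.\<close>
  have good: "alg_load k rule A \<sigma> T i \<le> 1 + 2 * \<epsilon>"
    if \<sigma>: "\<sigma> \<in> ?P" and i: "i < m" and Z: "?Z \<sigma> \<le> 2 * m / \<epsilon>"
      and \<rho>: "(\<Sum>t=1..T. ?\<rho> t \<sigma>) \<le> (\<Sum>t=1..T. s t)" for \<sigma> i
  proof -
    let ?x = "alg_load k rule A \<sigma> T i"
    have "w T \<sigma> i \<le> (\<Sum>i\<in>?I. w T \<sigma> i)"
      using i by (intro member_le_sum) (auto simp: w_def)
    also have "\<dots> \<le> exp L * ?D \<sigma>"
      using Z D(1)[OF \<sigma>] expL by (simp add: pos_divide_le_eq)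
    also have "\<dots> \<le> exp L * exp (c * (\<Sum>t=1..T. ?\<rho> t \<sigma>))"
      using D(2)[OF \<sigma>] by simp
    also have "\<dots> \<le> exp (L + c * (1 + \<epsilon> / 2))"
      using \<rho> S c by (simp add: exp_add)
    finally have "\<nu> * ?x \<le> L + c * (1 + \<epsilon> / 2)" by (simp add: w_def)
    then have "\<gamma> * (\<nu> * ?x) \<le> \<gamma> * (L + c * (1 + \<epsilon> / 2))"
      using gamma_pos by simp
    then have "ln (1 + \<epsilon>) * ?x \<le> \<gamma> * L + \<epsilon> * (1 + \<epsilon> / 2)"
      using gamma_pos by (simp add: nu_def c_def distrib_left)
    \<comment> \<open>Beyond \<open>\<epsilon>\<close>, the left side has at most
      \<open>5 / 8 * \<epsilon>\<^sup>2\<close> and the right side at least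
      \<open>5 / 4 * \<epsilon>\<^sup>2\<close>.\<close>
    also have "\<dots> \<le> (\<epsilon> - \<epsilon>\<^sup>2 / 2) * (1 + 2 * \<epsilon>)"
    proof -
      have "(\<epsilon> - \<epsilon>\<^sup>2 / 2) * (1 + 2 * \<epsilon>) = \<epsilon> + 3 / 2 * \<epsilon>\<^sup>2 - \<epsilon> * \<epsilon>\<^sup>2"
        by (simp add: field_simps power2_eq_square)
      moreover have "\<epsilon> * (1 + \<epsilon> / 2) = \<epsilon> + \<epsilon>\<^sup>2 / 2"
        by (simp add: algebra_simps power2_eq_square)
      moreover have "\<epsilon> * \<epsilon>\<^sup>2 \<le> 1 / 4 * \<epsilon>\<^sup>2"
        using eps_small by (intro mult_right_mono) auto
      ultimately show ?thesis using \<gamma>L zero_le_power2[of \<epsilon>] by linarith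
    qed
    also have "\<dots> \<le> ln (1 + \<epsilon>) * (1 + 2 * \<epsilon>)"
      using ln_one_plus_ge[of \<epsilon>] eps by (intro mult_right_mono) auto
    finally show ?thesis using eps by (simp add: mult_le_cancel_left)
  qed
  let ?load = "\<lambda>\<sigma> i. \<Sum>s=1..T. matvec k (A (\<sigma> s)) (alg_run rule A \<sigma> n ! (s - 1)) i"
  let ?bad = "{\<sigma>. \<sigma> permutes {1..n} \<and> Max {?load \<sigma> i | i. i < m} > 1 + 2 * \<epsilon>}"
  let ?badZ = "{\<sigma> \<in> ?P. 2 * m / \<epsilon> < ?Z \<sigma>}"
  let ?bad\<rho> = "{\<sigma>. \<sigma> permutes {1..n} \<and> (\<Sum>t=1..T. s t) < (\<Sum>t=1..T. ?\<rho> t \<sigma>)}"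
  \<comment> \<open>The full run of length \<open>n\<close> agrees with the run of length
    \<open>T\<close> on its first \<open>T\<close> entries.\<close>
  have load: "?load \<sigma> i = alg_load k rule A \<sigma> T i" for \<sigma> i
    unfolding alg_load_def using Tn
    by (intro sum.cong refl arg_cong[where f = "\<lambda>x. matvec k _ x i"] alg_run_nth) auto
  have "?bad \<subseteq> ?badZ \<union> ?bad\<rho>"
  proof
    fix \<sigma> assume bad: "\<sigma> \<in> ?bad"
    have "Max {?load \<sigma> i | i. i < m} \<in> {?load \<sigma> i | i. i < m}"
      using \<open>0 < m\<close> by (intro Max_in) auto
    then obtain i where "i < m" "1 + 2 * \<epsilon> < alg_load k rule A \<sigma> T i"
      using bad load by auto
    then show "\<sigma> \<in> ?badZ \<union> ?bad\<rho>" using good[of \<sigma> i] bad by fastforce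
  qed
  then have "card ?bad \<le> card (?badZ \<union> ?bad\<rho>)"
    by (intro card_mono) (auto simp: finite_permutations)
  also have "\<dots> \<le> card ?badZ + card ?bad\<rho>" by (rule card_Un_le)
  finally have "real (card ?bad) \<le> fact n * \<epsilon>"
    using bad_Z bad_tail by linarith
  then show ?thesis by (simp add: field_simps)
qed

end
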